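(* A formula $\varphi\in\mathrm{PL}(\{\veebar,\wedge,\vee,\mathbin{\dot\vee}\},\Phi)$ is local if and only if it is equivalent to its relaxation $\varphi^{\mathrm{lax}}$.
   Context: A domain $\Phi$ is a finite set of propositional variables (from an infinite supply); a $\Phi$-assignment is a map $s:\Phi\to\{0,1\}$; a $\Phi$-team is a set of $\Phi$-assignments. A split of $T$ is $(T_1,T_2)$ with $T_1,T_2\subseteq T$, $T_1\cup T_2=T$; strict if $T_1\cap T_2=\emptyset$. $\mathrm{PL}(\Sigma,\Phi)$ is the set of formulas built from the literals $\top,\bot,{\sim}\top,{\sim}\bot,p,\neg p,{\sim}p,{\sim}\neg p$ ($p\in\Phi$) by connectives in $\Sigma$. Semantics: $T\models\top$ always; $T\models\bot$ iff $T=\emptyset$; $T\models p$ iff $s(p)=1$ for all $s\in T$; $T\models\neg p$ iff $s(p)=0$ for all $s\in T$; $T\models{\sim}\ell$ iff $T\not\models\ell$; $\wedge$ conjunction; $T\models\psi\veebar\theta$ iff $T\models\psi$ or $T\models\theta$; $T\models\psi\vee\theta$ iff some split $(S,U)$ of $T$ has $S\models\psi$, $U\models\theta$; $\mathbin{\dot\vee}$ likewise with strict splits. For a $\Psi$-team $T$ and $\Phi\subseteq\Psi$, $T\restriction\Phi=\{s\restriction\Phi:s\in T\}$. A formula $\varphi\in\mathrm{PL}(\Sigma,\Phi)$ is local if for every domain $\Psi\supseteq\Phi$ and every $\Psi$-team $T$: $T\models\varphi$ iff $T\restriction\Phi\models\varphi$. Two formulas are equivalent if, for every domain containing all their variables,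 they are satisfied by the same teams. The relaxation $\varphi^{\mathrm{lax}}$ of $\varphi$ is obtained by replacing every occurrence of $\mathbin{\dot\vee}$ by $\vee$. *)

theory Defs
  imports Main
begin

datatype 'p atom = Top | Bot | Pos 'p | Neg 'p

datatype conn = Con_And | Con_BoolOr | Con_Or | Con_StrictOr

text \<open>\<open>Lit a\<close> and \<open>CLit a\<close> are the literals \<open>a\<close> and \<open>\<sim>a\<close>, where
  \<open>a\<close> is one of \<open>\<top>, \<bottom>, p, \<not>p\<close>.\<close>

datatype 'p form =
    Lit "'p atom"
  | CLit "'p atom"
  | Conn conn "'p form" "'p form"

abbreviation vars :: "'p form \<Rightarrow> 'p set" where
  "vars \<equiv> set_form"

inductive_set PL :: "conn set \<Rightarrow> 'p set \<Rightarrow> 'p form set"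
  for \<Sigma> :: "conn set" and \<Phi> :: "'p set" where
  PL_Lit: "set_atom a \<subseteq> \<Phi> \<Longrightarrow> Lit a \<in> PL \<Sigma> \<Phi>"
| PL_CLit: "set_atom a \<subseteq> \<Phi> \<Longrightarrow> CLit a \<in> PL \<Sigma> \<Phi>"
| PL_Conn: "c \<in> \<Sigma> \<Longrightarrow> \<phi> \<in> PL \<Sigma> \<Phi> \<Longrightarrow> \<psi> \<in> PL \<Sigma> \<Phi> \<Longrightarrow> Conn c \<phi> \<psi> \<in> PL \<Sigma> \<Phi>"

text \<open>A \<open>\<Phi>\<close>-assignment is a partial map whose domain is exactly \<open>\<Phi>\<close>.\<close>

type_synonym 'p assignment = "'p \<rightharpoonup> bool"
type_synonym 'p team = "'p assignment set"

definition is_domain :: "'p set \<Rightarrow> bool" where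
  "is_domain \<Phi> \<longleftrightarrow> finite \<Phi>"

definition is_team :: "'p set \<Rightarrow> 'p team \<Rightarrow> bool" where
  "is_team \<Phi> T \<longleftrightarrow> (\<forall>s\<in>T. dom s = \<Phi>)"

definition is_split :: "'p team \<Rightarrow> 'p team \<Rightarrow> 'p team \<Rightarrow> bool" where
  "is_split T T1 T2 \<longleftrightarrow> T1 \<subseteq> T \<and> T2 \<subseteq> T \<and> T1 \<union> T2 = T"

definition is_strict_split :: "'p team \<Rightarrow> 'p team \<Rightarrow> 'p team \<Rightarrow> bool" where
  "is_strict_split T T1 T2 \<longleftrightarrow> is_split T T1 T2 \<and> T1 \<inter> T2 = {}"

fun sat_atom :: "'p team \<Rightarrow> 'p atom \<Rightarrow> bool" where
  "sat_atom T Top \<longleftrightarrow> True"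
| "sat_atom T Bot \<longleftrightarrow> T = {}"
| "sat_atom T (Pos p) \<longleftrightarrow> (\<forall>s\<in>T. s p = Some True)"
| "sat_atom T (Neg p) \<longleftrightarrow> (\<forall>s\<in>T. s p = Some False)"

fun sat :: "'p team \<Rightarrow> 'p form \<Rightarrow> bool"  (infix \<open>\<Turnstile>\<close> 50) where
  "T \<Turnstile> Lit a \<longleftrightarrow> sat_atom T a"
| "T \<Turnstile> CLit a \<longleftrightarrow> \<not> sat_atom T a"
| "T \<Turnstile> Conn Con_And \<phi> \<psi> \<longleftrightarrow> T \<Turnstile> \<phi> \<and> T \<Turnstile> \<psi>"
| "T \<Turnstile> Conn Con_BoolOr \<phi> \<psi> \<longleftrightarrow> T \<Turnstile> \<phi> \<or> T \<Turnstile> \<psi>"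
| "T \<Turnstile> Conn Con_Or \<phi> \<psi> \<longleftrightarrow> (\<exists>S U. is_split T S U \<and> S \<Turnstile> \<phi> \<and> U \<Turnstile> \<psi>)"
| "T \<Turnstile> Conn Con_StrictOr \<phi> \<psi> \<longleftrightarrow> (\<exists>S U. is_strict_split T S U \<and> S \<Turnstile> \<phi> \<and> U \<Turnstile> \<psi>)"

definition team_restrict :: "'p team \<Rightarrow> 'p set \<Rightarrow> 'p team"  (infixl \<open>\<restriction>\<close> 90) where
  "T \<restriction> \<Phi> = (\<lambda>s. s |` \<Phi>) ` T"

definition is_local :: "'p set \<Rightarrow> 'p form \<Rightarrow> bool" where
  "is_local \<Phi> \<phi> \<longleftrightarrow>
     (\<forall>\<Psi> T. is_domain \<Psi> \<and> \<Phi> \<subseteq> \<Psi> \<and> is_team \<Psi> T \<longrightarrow> (T \<Turnstile> \<phi> \<longleftrightarrow> T \<restriction> \<Phi> \<Turnstile> \<phi>))"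

definition equivalent :: "'p form \<Rightarrow> 'p form \<Rightarrow> bool" where
  "equivalent \<phi> \<psi> \<longleftrightarrow>
     (\<forall>\<Psi> T. is_domain \<Psi> \<and> vars \<phi> \<union> vars \<psi> \<subseteq> \<Psi> \<and> is_team \<Psi> T \<longrightarrow> (T \<Turnstile> \<phi> \<longleftrightarrow> T \<Turnstile> \<psi>))"

fun lax :: "'p form \<Rightarrow> 'p form" where
  "lax (Lit a) = Lit a"
| "lax (CLit a) = CLit a"
| "lax (Conn c \<phi> \<psi>) = Conn (if c = Con_StrictOr then Con_Or else c) (lax \<phi>) (lax \<psi>)"

end

theory Submission
  imports Defs
begin

text \<open>A formula without strict splits only sees the restriction of a team to its variables, so
  every relaxation is local. Conversely, give each member of a \<open>\<Phi>\<close>-team \<open>T\<close> sufficiently many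
  copies by adding fresh variables. A lax split of \<open>T\<close> then lifts to a strict split of the inflated
  team, by distributing the copies of the doubly used assignments evenly; hence the inflated
  team satisfies \<open>\<phi>\<close> as soon as \<open>T\<close> satisfies its relaxation, and locality brings \<open>\<phi>\<close> back to \<open>T\<close>.\<close>

section \<open>Relaxed formulas under changes outside their variables\<close>

lemma sat_atom_image:
  assumes "\<And>s p. s \<in> T \<Longrightarrow> p \<in> set_atom a \<Longrightarrow> f s p = s p"
  shows "sat_atom (f ` T) a \<longleftrightarrow> sat_atom T a"
  using assms by (cases a) auto

lemma vars_lax [simp]: "vars (lax \<phi>) = vars \<phi>"
  by (induction \<phi>) auto

lemma PL_vars: "\<phi> \<in> PL \<Sigma> \<Phi> \<Longrightarrow> vars \<phi> \<subseteq> \<Phi>"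
  by (induction rule: PL.induct) auto

text \<open>A strict split is in particular a split, and negation occurs only in literals, so
  weakening a disjunction deep inside weakens the whole formula.\<close>

lemma sat_imp_sat_lax: "T \<Turnstile> \<phi> \<Longrightarrow> T \<Turnstile> lax \<phi>"
proof (induction \<phi> arbitrary: T)
  case (Conn c \<phi> \<psi>)
  then show ?case
    by (cases c) (auto simp: is_strict_split_def)
qed auto

lemma split_image: "is_split T S U \<Longrightarrow> is_split (f ` T) (f ` S) (f ` U)"
  by (auto simp: is_split_def)

lemma split_preimage:
  assumes "is_split (f ` T) S U"
  shows "is_split T {s \<in> T. f s \<in> S} {s \<in> T. f s \<in> U}"
    and "f ` {s \<in> T. f s \<in> S} = S" and "f ` {s \<in> T. f s \<in> U} = U"
  using assms by (auto simp: is_split_def)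

text \<open>Splits transfer both ways, forwards by images and backwards by full preimages. Since
  \<open>f\<close> may merge assignments, this covers restriction to a smaller domain and thus gives
  the locality of relaxations.\<close>

lemma sat_lax_image:
  assumes "\<And>s p. s \<in> T \<Longrightarrow> p \<in> vars \<phi> \<Longrightarrow> f s p = s p"
  shows "f ` T \<Turnstile> lax \<phi> \<longleftrightarrow> T \<Turnstile> lax \<phi>"
  using assms
proof (induction \<phi> arbitrary: T)
  case (Lit a)
  then show ?case by (simp add: sat_atom_image)
next
  case (CLit a)
  then show ?case by (simp add: sat_atom_image)
next
  case (Conn c \<phi> \<psi>)
  have IH: "f ` S \<Turnstile> lax \<phi> \<longleftrightarrow> S \<Turnstile> lax \<phi>" "f ` S \<Turnstile> lax \<psi> \<longleftrightarrow> S \<Turnstile> lax \<psi>" if "S \<subseteq> T" for S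
    using Conn.IH[of S] Conn.prems that by auto
  have split: "f ` T \<Turnstile> Conn Con_Or (lax \<phi>) (lax \<psi>) \<longleftrightarrow> T \<Turnstile> Conn Con_Or (lax \<phi>) (lax \<psi>)"
  proof
    assume "f ` T \<Turnstile> Conn Con_Or (lax \<phi>) (lax \<psi>)"
    then obtain S U where SU: "is_split (f ` T) S U" "S \<Turnstile> lax \<phi>" "U \<Turnstile> lax \<psi>" by auto
    have "{s \<in> T. f s \<in> S} \<Turnstile> lax \<phi>" "{s \<in> T. f s \<in> U} \<Turnstile> lax \<psi>"
      using SU split_preimage[OF SU(1)] IH[of "{s \<in> T. f s \<in> S}"] IH[of "{s \<in> T. f s \<in> U}"]
      by auto
    then show "T \<Turnstile> Conn Con_Or (lax \<phi>) (lax \<psi>)"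
      using split_preimage(1)[OF SU(1)] by auto
  next
    assume "T \<Turnstile> Conn Con_Or (lax \<phi>) (lax \<psi>)"
    then obtain S U where SU: "is_split T S U" "S \<Turnstile> lax \<phi>" "U \<Turnstile> lax \<psi>" by auto
    then have "f ` S \<Turnstile> lax \<phi>" "f ` U \<Turnstile> lax \<psi>"
      using IH by (auto simp: is_split_def)
    then show "f ` T \<Turnstile> Conn Con_Or (lax \<phi>) (lax \<psi>)"
      using split_image[OF SU(1)] by auto
  qed
  show ?case
    using IH[of T] split by (cases c) auto
qed

section \<open>Arbitrary formulas under injective changes\<close>

lemma strict_split_image_inj:
  assumes "inj_on f T" "is_strict_split T S U"
  shows "is_strict_split (f ` T) (f ` S) (f ` U)"
  using assms inj_on_image_Int[of f T S U]
  by (auto simp: is_strict_split_def is_split_def)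

text \<open>Injectivity matters at strict disjunctions: disjoint parts must keep disjoint images.
  The converse below follows by applying this to the inverse of \<open>f\<close>.\<close>

lemma sat_image_if_inj:
  assumes "inj_on f T" "\<And>s p. s \<in> T \<Longrightarrow> p \<in> vars \<phi> \<Longrightarrow> f s p = s p" "T \<Turnstile> \<phi>"
  shows "f ` T \<Turnstile> \<phi>"
  using assms
proof (induction \<phi> arbitrary: T)
  case (Lit a)
  then show ?case by (simp add: sat_atom_image)
next
  case (CLit a)
  then show ?case by (simp add: sat_atom_image)
next
  case (Conn c \<phi> \<psi>)
  have IH: "S \<Turnstile> \<phi> \<Longrightarrow> f ` S \<Turnstile> \<phi>" "S \<Turnstile> \<psi> \<Longrightarrow> f ` S \<Turnstile> \<psi>" if "S \<subseteq> T" for S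
    using Conn.IH[of S] Conn.prems(1,2) that by (auto intro: inj_on_subset)
  show ?case
  proof (cases c)
    case Con_Or
    then obtain S U where SU: "is_split T S U" "S \<Turnstile> \<phi>" "U \<Turnstile> \<psi>"
      using Conn.prems(3) by auto
    then have "f ` S \<Turnstile> \<phi>" "f ` U \<Turnstile> \<psi>"
      using IH by (auto simp: is_split_def)
    then show ?thesis
      using split_image[OF SU(1)] Con_Or by auto
  next
    case Con_StrictOr
    then obtain S U where SU: "is_strict_split T S U" "S \<Turnstile> \<phi>" "U \<Turnstile> \<psi>"
      using Conn.prems(3) by auto
    then have "f ` S \<Turnstile> \<phi>" "f ` U \<Turnstile> \<psi>"
      using IH by (auto simp: is_strict_split_def is_split_def)
    then show ?thesis
      using strict_split_image_inj[OF Conn.prems(1) SU(1)] Con_StrictOr by auto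
  qed (use IH[of T] Conn.prems(3) in auto)
qed

lemma sat_image_inj:
  assumes inj: "inj_on f T" and agree: "\<And>s p. s \<in> T \<Longrightarrow> p \<in> vars \<phi> \<Longrightarrow> f s p = s p"
  shows "f ` T \<Turnstile> \<phi> \<longleftrightarrow> T \<Turnstile> \<phi>"
proof
  assume "f ` T \<Turnstile> \<phi>"
  moreover have "inv_into T f s p = s p" if "s \<in> f ` T" "p \<in> vars \<phi>" for s p
    using that inj agree by auto
  ultimately have "inv_into T f ` f ` T \<Turnstile> \<phi>"
    by (intro sat_image_if_inj[of "inv_into T f"] inj_on_inv_into) auto
  then show "T \<Turnstile> \<phi>"
    using inj by (simp add: inv_into_image_cancel)
qed (use assms sat_image_if_inj in blast)

section \<open>Lifting lax splits to strict splits of inflated teams\<close>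

lemma nonempty_if_power_le_card: "2 ^ n \<le> card X \<Longrightarrow> X \<noteq> {}"
  by auto

text \<open>A fibre over an assignment lying in both \<open>S\<close> and \<open>U\<close> is cut in
  two, which costs one factor of 2. As infinite sets have \<open>card\<close> 0, the bound also
  forces the fibres to be finite.\<close>

lemma strict_split_lift:
  assumes split: "is_split (f ` T) S U"
    and fibres: "\<And>t. t \<in> f ` T \<Longrightarrow> 2 ^ Suc n \<le> card {s \<in> T. f s = t}"
  obtains S' U' where "is_strict_split T S' U'" "f ` S' = S" "f ` U' = U"
    "\<And>t. t \<in> S \<Longrightarrow> 2 ^ n \<le> card {s \<in> S'. f s = t}"
    "\<And>t. t \<in> U \<Longrightarrow> 2 ^ n \<le> card {s \<in> U'. f s = t}"
proof -
  let ?F = "\<lambda>t. {s \<in> T. f s = t}"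
  have "\<forall>t \<in> f ` T. \<exists>H. H \<subseteq> ?F t \<and> card H = 2 ^ n"
  proof
    fix t assume "t \<in> f ` T"
    then have "2 ^ n \<le> card (?F t)"
      using fibres[of t] by simp
    then show "\<exists>H. H \<subseteq> ?F t \<and> card H = 2 ^ n"
      by (rule obtain_subset_with_card_n) auto
  qed
  then obtain H where "\<forall>t \<in> f ` T. H t \<subseteq> ?F t \<and> card (H t) = 2 ^ n"
    by (rule bchoice[THEN exE])
  then have H: "H t \<subseteq> ?F t \<and> card (H t) = 2 ^ n" if "t \<in> f ` T" for t
    using that by (rule bspec)
  \<comment> \<open>Fibres over \<open>S\<close> alone go entirely to \<open>S'\<close>, those over
    \<open>U\<close> alone entirely to \<open>U'\<close>. Over a common \<open>t\<close>,
    \<open>S'\<close> receives \<open>H t\<close> and \<open>U'\<close> the remainder, which still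
    has at least \<open>2 ^ n\<close> members.\<close>
  define S' where "S' = {s \<in> T. f s \<in> S \<and> (f s \<in> U \<longrightarrow> s \<in> H (f s))}"
  define U' where "U' = T - S'"
  have SU: "S \<union> U = f ` T"
    using split by (auto simp: is_split_def)
  have S_card: "2 ^ n \<le> card {s \<in> S'. f s = t}" if "t \<in> S" for t
  proof (cases "t \<in> U")
    case True
    have t: "t \<in> f ` T" using that SU by auto
    have "{s \<in> S'. f s = t} = H t"
      using True that H[OF t] by (auto simp: S'_def)
    then show ?thesis
      using H[OF t] by simp
  next
    case False
    then have "{s \<in> S'. f s = t} = ?F t"
      using that by (auto simp: S'_def)
    moreover have "t \<in> f ` T" using that SU by auto
    ultimately show ?thesis
      using fibres[of t] by auto
  qed
  have U_card: "2 ^ n \<le> card {s \<in> U'. f s = t}" if "t \<in> U" for t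
  proof (cases "t \<in> S")
    case True
    have t: "t \<in> f ` T" using that SU by auto
    have "{s \<in> U'. f s = t} = ?F t - H t"
      using True that by (auto simp: S'_def U'_def)
    moreover have "finite (H t)"
      using H[OF t] by (intro card_ge_0_finite) auto
    ultimately show ?thesis
      using H[OF t] fibres[OF t] by (simp add: card_Diff_subset)
  next
    case False
    then have "{s \<in> U'. f s = t} = ?F t"
      using that by (auto simp: S'_def U'_def)
    moreover have "t \<in> f ` T" using that SU by auto
    ultimately show ?thesis
      using fibres[of t] by auto
  qed
  have image: "f ` X = Y"
    if fibre: "\<And>t. t \<in> Y \<Longrightarrow> 2 ^ n \<le> card {s \<in> X. f s = t}" and sub: "f ` X \<subseteq> Y" for X Y
  proof -
    have "t \<in> f ` X" if "t \<in> Y" for t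
    proof -
      have "{s \<in> X. f s = t} \<noteq> {}"
        using nonempty_if_power_le_card fibre[OF that] by blast
      then show ?thesis by auto
    qed
    then show ?thesis using sub by blast
  qed
  have "f ` S' \<subseteq> S" "f ` U' \<subseteq> U"
    using SU by (auto simp: S'_def U'_def)
  then have "f ` S' = S" "f ` U' = U"
    using image S_card U_card by blast+
  moreover have "is_strict_split T S' U'"
    by (auto simp: is_strict_split_def is_split_def S'_def U'_def)
  ultimately show ?thesis
    using that S_card U_card by blast
qed

text \<open>The exponent \<open>n\<close> bounds how often fibres can still be halved. Each
  connective uses up at most one halving, and the size of a formula bounds its nesting
  depth.\<close>

lemma sat_if_image_sat_lax:
  assumes "\<And>s p. s \<in> T \<Longrightarrow> p \<in> vars \<phi> \<Longrightarrow> f s p = s p"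
    and "\<And>t. t \<in> f ` T \<Longrightarrow> 2 ^ n \<le> card {s \<in> T. f s = t}"
    and "size \<phi> \<le> n"
    and "f ` T \<Turnstile> lax \<phi>"
  shows "T \<Turnstile> \<phi>"
  using assms
proof (induction \<phi> arbitrary: T n)
  case (Lit a)
  then show ?case by (simp add: sat_atom_image)
next
  case (CLit a)
  then show ?case by (simp add: sat_atom_image)
next
  case (Conn c \<phi> \<psi>)
  obtain m where m: "n = Suc m" "size \<phi> \<le> m" "size \<psi> \<le> m"
    using Conn.prems(3) by (cases n) auto
  have IH: "f ` S \<Turnstile> lax \<phi> \<Longrightarrow> S \<Turnstile> \<phi>" "f ` S \<Turnstile> lax \<psi> \<Longrightarrow> S \<Turnstile> \<psi>"
    if "S \<subseteq> T" "\<And>t. t \<in> f ` S \<Longrightarrow> 2 ^ m \<le> card {s \<in> S. f s = t}" for S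
    using Conn.IH[of S m] Conn.prems(1) that m by auto
  have large: "2 ^ m \<le> card {s \<in> T. f s = t}" if "t \<in> f ` T" for t
    using Conn.prems(2)[OF that] m(1) by simp
  show ?case
  proof (cases c)
    case Con_Or
    then obtain S U where SU: "is_split (f ` T) S U" "S \<Turnstile> lax \<phi>" "U \<Turnstile> lax \<psi>"
      using Conn.prems(4) by auto
    \<comment> \<open>A lax disjunction permits overlap, so full preimages serve as the parts and
      every fibre stays whole.\<close>
    have fibre: "2 ^ m \<le> card {s \<in> {s \<in> T. f s \<in> X}. f s = t}"
      if "t \<in> f ` {s \<in> T. f s \<in> X}" for t X
    proof -
      have "{s \<in> {s \<in> T. f s \<in> X}. f s = t} = {s \<in> T. f s = t}" "t \<in> f ` T"
        using that by auto
      then show ?thesis using large by simp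
    qed
    have "{s \<in> T. f s \<in> S} \<Turnstile> \<phi>"
      by (rule IH(1)) (use fibre SU split_preimage[OF SU(1)] in auto)
    moreover have "{s \<in> T. f s \<in> U} \<Turnstile> \<psi>"
      by (rule IH(2)) (use fibre SU split_preimage[OF SU(1)] in auto)
    ultimately show ?thesis
      using split_preimage(1)[OF SU(1)] Con_Or by auto
  next
    case Con_StrictOr
    then obtain S U where SU: "is_split (f ` T) S U" "S \<Turnstile> lax \<phi>" "U \<Turnstile> lax \<psi>"
      using Conn.prems(4) by auto
    obtain S' U' where SU': "is_strict_split T S' U'" "f ` S' = S" "f ` U' = U"
      "\<And>t. t \<in> S \<Longrightarrow> 2 ^ m \<le> card {s \<in> S'. f s = t}"
      "\<And>t. t \<in> U \<Longrightarrow> 2 ^ m \<le> card {s \<in> U'. f s = t}"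
      using strict_split_lift[OF SU(1) Conn.prems(2)[unfolded m(1)]] by blast
    then have "S' \<Turnstile> \<phi>" "U' \<Turnstile> \<psi>"
      using IH[of S'] IH[of U'] SU by (auto simp: is_strict_split_def is_split_def)
    then show ?thesis
      using SU'(1) Con_StrictOr by auto
  qed (use IH[of T] large Conn.prems(4) in auto)
qed

section \<open>Fresh variables and locality\<close>

lemma card_extensions:
  assumes "finite \<Phi>" "finite N" "\<Phi> \<inter> N = {}" "dom t = \<Phi>"
  shows "2 ^ card N \<le> card {s :: 'p assignment. dom s = \<Phi> \<union> N \<and> s |` \<Phi> = t}"
proof -
  let ?E = "{s :: 'p assignment. dom s = \<Phi> \<union> N \<and> s |` \<Phi> = t}"
  \<comment> \<open>Each subset of \<open>N\<close> yields its own extension of \<open>t\<close>, by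
    its characteristic function on \<open>N\<close>.\<close>
  define e where "e A = (\<lambda>p. if p \<in> N then Some (p \<in> A) else t p)" for A
  have "inj_on e (Pow N)"
  proof (rule inj_onI)
    fix A B assume AB: "A \<in> Pow N" "B \<in> Pow N" "e A = e B"
    have "p \<in> A \<longleftrightarrow> p \<in> B" if "p \<in> N" for p
      using fun_cong[OF AB(3), of p] that by (simp add: e_def)
    then show "A = B" using AB by auto
  qed
  moreover have "e ` Pow N \<subseteq> ?E"
    using assms by (fastforce simp: e_def restrict_map_def dom_def fun_eq_iff)
  moreover have "finite ?E"
    using finite_set_of_finite_maps[of "\<Phi> \<union> N" "UNIV :: bool set"] assms
    by (auto elim: finite_subset[rotated])
  ultimately have "card (Pow N) \<le> card ?E"
    by (rule card_inj_on_le)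
  then show ?thesis
    using assms by (simp add: card_Pow)
qed

lemma local_sat_iff_sat_lax:
  fixes \<phi> :: "'p form"
  assumes inf: "infinite (UNIV :: 'p set)" and fin: "finite \<Phi>" and vars: "vars \<phi> \<subseteq> \<Phi>"
    and local: "is_local \<Phi> \<phi>" and T: "is_team \<Phi> T"
  shows "T \<Turnstile> \<phi> \<longleftrightarrow> T \<Turnstile> lax \<phi>"
proof
  assume sat: "T \<Turnstile> lax \<phi>"
  have "infinite (- \<Phi>)"
    using inf fin by (simp add: Compl_eq_Diff_UNIV)
  \<comment> \<open>With \<open>size \<phi>\<close> fresh variables, every assignment in
    \<open>T\<close> has at least \<open>2 ^ size \<phi>\<close> extensions, enough for all the
    halvings. The team \<open>T'\<close> collects all of them.\<close>
  then obtain N where N: "finite N" "card N = size \<phi>" "N \<subseteq> - \<Phi>"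
    using infinite_arbitrarily_large by blast
  then have disj: "\<Phi> \<inter> N = {}" by auto
  let ?r = "\<lambda>s :: 'p assignment. s |` \<Phi>"
  define T' where "T' = {s. dom s = \<Phi> \<union> N \<and> s |` \<Phi> \<in> T}"
  have fibre: "2 ^ size \<phi> \<le> card {s \<in> T'. s |` \<Phi> = t}" if "t \<in> T" for t
  proof -
    have "{s \<in> T'. s |` \<Phi> = t} = {s. dom s = \<Phi> \<union> N \<and> s |` \<Phi> = t}"
      using that by (auto simp: T'_def)
    then show ?thesis
      using card_extensions[OF fin N(1) disj, of t] that T N(2) by (simp add: is_team_def)
  qed
  have image: "?r ` T' = T"
  proof
    show "T \<subseteq> ?r ` T'"
    proof
      fix t assume "t \<in> T"
      then have "{s \<in> T'. s |` \<Phi> = t} \<noteq> {}"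
        using nonempty_if_power_le_card fibre by blast
      then show "t \<in> ?r ` T'" by auto
    qed
  qed (auto simp: T'_def)
  have "T' \<Turnstile> \<phi>"
  proof (rule sat_if_image_sat_lax[where f = ?r and n = "size \<phi>"])
    show "(s |` \<Phi>) p = s p" if "p \<in> vars \<phi>" for s :: "'p assignment" and p
      using that vars by auto
  qed (use image fibre sat in simp_all)
  moreover have "is_team (\<Phi> \<union> N) T'"
    by (simp add: is_team_def T'_def)
  ultimately have "T' \<restriction> \<Phi> \<Turnstile> \<phi>"
    using local fin N(1) unfolding is_local_def is_domain_def by blast
  then show "T \<Turnstile> \<phi>"
    using image by (simp add: team_restrict_def)
qed (rule sat_imp_sat_lax)

theorem theorem3p16:
  fixes \<Phi> :: "'p set" and \<phi> :: "'p form"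
  assumes "infinite (UNIV :: 'p set)"
    and "is_domain \<Phi>"
    and "\<phi> \<in> PL {Con_BoolOr, Con_And, Con_Or, Con_StrictOr} \<Phi>"
  shows "is_local \<Phi> \<phi> \<longleftrightarrow> equivalent \<phi> (lax \<phi>)"
proof
  have vars: "vars \<phi> \<subseteq> \<Phi>" and fin: "finite \<Phi>"
    using assms PL_vars by (auto simp: is_domain_def)
  have lax_restrict: "T \<restriction> \<Phi> \<Turnstile> lax \<phi> \<longleftrightarrow> T \<Turnstile> lax \<phi>" for T
    unfolding team_restrict_def using vars by (intro sat_lax_image) auto
  have team_restrict: "is_team \<Phi> (T \<restriction> \<Phi>)" if "is_team \<Psi> T" "\<Phi> \<subseteq> \<Psi>" for T \<Psi>
    using that by (auto simp: is_team_def team_restrict_def)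
  {
    assume local: "is_local \<Phi> \<phi>"
    show "equivalent \<phi> (lax \<phi>)"
      unfolding equivalent_def
    proof (intro allI impI)
      fix \<Psi> T assume "is_domain \<Psi> \<and> vars \<phi> \<union> vars (lax \<phi>) \<subseteq> \<Psi> \<and> is_team \<Psi> T"
      then have \<Psi>: "finite \<Psi>" "vars \<phi> \<subseteq> \<Psi>" "is_team \<Psi> T"
        by (auto simp: is_domain_def)
      \<comment> \<open>\<open>\<Psi>\<close> need not contain \<open>\<Phi>\<close>, so \<open>T\<close> is first padded to a team on \<open>\<Psi> \<union> \<Phi>\<close>.\<close>
      define e :: "'p assignment \<Rightarrow> 'p assignment"
        where "e s = (\<lambda>p. if p \<in> \<Phi> - \<Psi> then Some True else s p)" for s
      have e_team: "is_team (\<Psi> \<union> \<Phi>) (e ` T)"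
        using \<Psi>(3) by (fastforce simp: is_team_def e_def dom_def split: if_splits)
      have e_agree: "e s p = s p" if "p \<in> vars \<phi>" for s p
        using that \<Psi>(2) by (auto simp: e_def)
      have "e s |` \<Psi> = s" if "s \<in> T" for s
      proof
        have "dom s = \<Psi>" using that \<Psi>(3) by (simp add: is_team_def)
        then show "(e s |` \<Psi>) p = s p" for p
          by (cases "p \<in> \<Psi>") (auto simp: e_def restrict_map_def)
      qed
      then have "inj_on e T"
        by (metis inj_onI)
      \<comment> \<open>Padding is injective and leaves the variables of \<phi> alone, so it
        preserves even strict disjunctions. Locality then leads down to a \<Phi>-team, where \<phi>
        may be relaxed; the relaxation sees neither the restriction nor the padding.\<close>
      then have "T \<Turnstile> \<phi> \<longleftrightarrow> e ` T \<Turnstile> \<phi>"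
        using sat_image_inj e_agree by blast
      also have "\<dots> \<longleftrightarrow> (e ` T) \<restriction> \<Phi> \<Turnstile> \<phi>"
        using local e_team \<Psi>(1) fin unfolding is_local_def is_domain_def by blast
      also have "\<dots> \<longleftrightarrow> (e ` T) \<restriction> \<Phi> \<Turnstile> lax \<phi>"
        using local_sat_iff_sat_lax assms(1) fin vars local team_restrict e_team by blast
      also have "\<dots> \<longleftrightarrow> T \<Turnstile> lax \<phi>"
        using lax_restrict sat_lax_image e_agree by blast
      finally show "T \<Turnstile> \<phi> \<longleftrightarrow> T \<Turnstile> lax \<phi>" .
    qed
  }
  {
    assume "equivalent \<phi> (lax \<phi>)"
    then have equiv: "T \<Turnstile> \<phi> \<longleftrightarrow> T \<Turnstile> lax \<phi>" if "finite \<Psi>" "\<Phi> \<subseteq> \<Psi>" "is_team \<Psi> T" for \<Psi> T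
      using that vars by (auto simp: equivalent_def is_domain_def)
    \<comment> \<open>Both \<open>T\<close> and its restriction are teams over domains containing
      \<Phi>, so \<phi> can be exchanged for its relaxation on either side, and the relaxation is
      local.\<close>
    show "is_local \<Phi> \<phi>"
      unfolding is_local_def is_domain_def
      using equiv lax_restrict team_restrict fin by (metis order_refl)
  }
qed

end
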